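(* For every integer $n\ge1$ and every $f\in\mathcal{T}_n$, $$\|f\|_{[0,1]} \le \frac{\pi n}{2}\, \|f\|_{L_2[0,1]}.$$
   Context: For an integer $n\ge1$, $\mathcal{T}_n$ denotes the set of all functions $f:\mathbb{R}\to\mathbb{C}$ of the form $f(t)=\sum_{j=1}^n a_j e^{i\lambda_j t}$ with $a_j\in\mathbb{C}$ (possibly zero) and real exponents $\lambda_1<\lambda_2<\cdots<\lambda_n$. For $A\subset\mathbb{R}$, $\|f\|_A:=\sup_{t\in A}|f(t)|$; $\|f\|_{L_2[0,1]}=(\int_0^1|f|^2)^{1/2}$. *)

theory Defs
  imports "HOL-Analysis.Analysis"
begin

definition exp_sums :: "nat \<Rightarrow> (real \<Rightarrow> complex) set" where
  "exp_sums n = {f. \<exists>(a :: nat \<Rightarrow> complex) (lam :: nat \<Rightarrow> real).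
      strict_mono_on {1..n} lam \<and>
      f = (\<lambda>t. \<Sum>j=1..n. a j * exp (\<i> * complex_of_real (lam j * t)))}"

definition sup_norm_on :: "real set \<Rightarrow> (real \<Rightarrow> complex) \<Rightarrow> real" where
  "sup_norm_on A f = (SUP t\<in>A. cmod (f t))"

definition L2_norm_01 :: "(real \<Rightarrow> complex) \<Rightarrow> real" where
  "L2_norm_01 f = sqrt (integral {0..1} (\<lambda>t. (cmod (f t))\<^sup>2))"

end

theory Submission
  imports Defs "HOL-Real_Asymp.Real_Asymp"
begin

text \<open>
  Suppose \<open>p\<close> is a polynomial of degree at most \<open>N\<close> with constant coefficient \<open>1\<close> that vanishes at
  the \<open>n\<close> points \<open>exp (\<i> \<lambda>\<^sub>j / N)\<close>. Then \<open>f 0\<close> is minus the combination of the samples \<open>f (k / N)\<close>,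
  \<open>1 \<le> k \<le> N\<close>, with the remaining coefficients of \<open>p\<close>, and the Cauchy--Schwarz inequality bounds it.
  To get a \<open>p\<close> with small coefficients, iterate on a pair \<open>(p, q)\<close> a multiplication of \<open>q\<close> by \<open>w z\<close>
  with \<open>w\<close> unimodular, followed by the rotation-dilation with matrix rows \<open>(1, -t)\<close> and \<open>(t, 1)\<close>.
  Each step multiplies the sum of squared coefficients by exactly \<open>1 + t\<^sup>2\<close>, while at \<open>z = 1 / w\<close> it
  is a rotation by \<open>arctan t\<close> up to scaling; hence for \<open>t = tan (\<pi> / 2K)\<close> the first component
  vanishes there after \<open>K\<close> steps. Doing this for each of the \<open>n\<close> points gives \<open>N = n K\<close> and squared
  coefficient sum \<open>(1 + t\<^sup>2) ^ (n K)\<close>, which is \<open>1 + (\<pi> n / 2)\<^sup>2 / N + o(1 / N)\<close>. Letting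
  \<open>K \<rightarrow> \<infinity>\<close> turns the sample sums into an integral and bounds \<open>f\<close> at an endpoint of an interval.
  For an interior point \<open>y\<close>, add the rescaled bounds on \<open>[0, y]\<close> and \<open>[y, 1]\<close>, whose left-hand sides
  carry the factors \<open>y\<close> and \<open>1 - y\<close>.
\<close>

section \<open>Polynomials with unimodular roots and small coefficients\<close>

definition energy :: "complex poly \<Rightarrow> real" where
  "energy p = (\<Sum>k\<le>degree p. (cmod (coeff p k))\<^sup>2)"

lemma energy_eq_sum:
  assumes "degree p \<le> D"
  shows "energy p = (\<Sum>k\<le>D. (cmod (coeff p k))\<^sup>2)"
  unfolding energy_def using assms
  by (intro sum.mono_neutral_left) (auto simp: coeff_eq_0)

lemma energy_smult_pCons_0:
  assumes "cmod w = 1"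
  shows "energy (smult w (pCons 0 p)) = energy p"
proof -
  have "degree (smult w (pCons 0 p)) \<le> Suc (degree p)"
    by (meson degree_pCons_le degree_smult_le order_trans)
  then have "energy (smult w (pCons 0 p)) = (\<Sum>k\<le>Suc (degree p). (cmod (coeff (smult w (pCons 0 p)) k))\<^sup>2)"
    by (rule energy_eq_sum)
  also have "\<dots> = energy p"
    using assms by (simp only: sum.atMost_Suc_shift) (simp add: energy_def norm_mult)
  finally show ?thesis .
qed

text \<open>The matrix with rows \<open>(1, -t)\<close> and \<open>(t, 1)\<close> is
  \<open>sqrt (1 + t\<^sup>2)\<close> times a rotation and acts on each pair of coefficients
  separately.\<close>

lemma energy_rotate:
  fixes t :: real
  shows "energy (p - smult (of_real t) q) + energy (smult (of_real t) p + q)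
       = (1 + t\<^sup>2) * (energy p + energy q)"
proof -
  define D where "D = max (degree p) (degree q)"
  have d: "degree p \<le> D" "degree q \<le> D"
    by (auto simp: D_def)
  then have "degree (p - smult (of_real t) q) \<le> D" "degree (smult (of_real t) p + q) \<le> D"
    by (auto intro!: degree_diff_le degree_add_le order_trans[OF degree_smult_le])
  moreover have "(cmod (a - of_real t * b))\<^sup>2 + (cmod (of_real t * a + b))\<^sup>2
      = (1 + t\<^sup>2) * ((cmod a)\<^sup>2 + (cmod b)\<^sup>2)" for a b :: complex
    by (simp only: cmod_power2) (simp add: power2_eq_square algebra_simps)
  ultimately show ?thesis
    using d by (simp add: energy_eq_sum[where D = D] flip: sum.distrib) (simp add: sum_distrib_left)
qed

primrec rot_poly :: "complex \<Rightarrow> real \<Rightarrow> complex poly \<Rightarrow> nat \<Rightarrow> complex poly \<times> complex poly" where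
  "rot_poly w t u 0 = (u, 0)"
| "rot_poly w t u (Suc k) = (case rot_poly w t u k of (p, q) \<Rightarrow>
     let q' = smult w (pCons 0 q) in (p - smult (of_real t) q', smult (of_real t) p + q'))"

lemma rot_poly_energy:
  assumes "cmod w = 1"
  shows "energy (fst (rot_poly w t u k)) + energy (snd (rot_poly w t u k)) = (1 + t\<^sup>2) ^ k * energy u"
proof (induction k)
  case 0
  show ?case by (simp add: energy_def)
next
  case (Suc k)
  then show ?case
    by (simp add: case_prod_unfold Let_def energy_rotate energy_smult_pCons_0[OF assms]
          del: smult_pCons smult_smult)
qed

lemma rot_poly_degree:
  "degree (fst (rot_poly w t u k)) \<le> degree u + k \<and> degree (snd (rot_poly w t u k)) \<le> degree u + k"
proof (induction k)
  case (Suc k)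
  then have "degree (smult w (pCons 0 (snd (rot_poly w t u k)))) \<le> degree u + Suc k"
    by (metis (no_types, lifting) Suc_le_mono add_Suc_right degree_pCons_le degree_smult_le order_trans)
  with Suc show ?case
    by (auto simp: case_prod_unfold Let_def simp del: smult_pCons
        intro!: degree_diff_le degree_add_le order_trans[OF degree_smult_le])
qed simp

text \<open>The shift gives \<open>q'\<close> constant coefficient 0, so subtracting a multiple of
  it does not affect that of the first component.\<close>

lemma rot_poly_coeff_0: "coeff (fst (rot_poly w t u k)) 0 = coeff u 0"
  by (induction k) (simp_all add: case_prod_unfold Let_def)

lemma rot_poly_root:
  assumes "poly u z = 0"
  shows "poly (fst (rot_poly w t u k)) z = 0 \<and> poly (snd (rot_poly w t u k)) z = 0"
  by (induction k) (simp_all add: case_prod_unfold Let_def assms)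

text \<open>With \<open>w * z = 1\<close> the shift leaves values at \<open>z\<close> unchanged. A
  step then acts on the two real factors of \<open>poly u z\<close>, read as one complex number, as
  multiplication by \<open>Complex 1 t\<close>.\<close>

lemma rot_poly_eval:
  assumes "w * z = 1"
  shows "poly (fst (rot_poly w t u k)) z = of_real (Re ((Complex 1 t) ^ k)) * poly u z
       \<and> poly (snd (rot_poly w t u k)) z = of_real (Im ((Complex 1 t) ^ k)) * poly u z"
proof (induction k)
  case (Suc k)
  have "w * (z * x) = x" for x
    by (metis assms mult.assoc mult_1)
  with Suc assms show ?case
    by (simp add: case_prod_unfold Let_def algebra_simps)
qed simp

text \<open>\<open>Complex 1 (tan x)\<close> has argument \<open>x = pi / (2 * real K)\<close>, so
  its \<open>K\<close>-th power lies on the imaginary axis. For \<open>K = 1\<close> this fails, as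
  \<open>tan (pi / 2)\<close> is 0 by the convention on division by 0.\<close>

lemma Re_Complex_tan_power:
  assumes "K \<ge> 2"
  shows "Re ((Complex 1 (tan (pi / (2 * real K)))) ^ K) = 0"
proof -
  define x where "x = pi / (2 * real K)"
  have "x < pi / 2" "0 < x"
    using assms by (auto simp: x_def divide_simps)
  then have c: "cos x \<noteq> 0"
    using cos_gt_zero[of x] by simp
  have "Complex 1 (tan x) = of_real (1 / cos x) * cis x"
    using c by (simp add: complex_eq_iff tan_def)
  then have "(Complex 1 (tan x)) ^ K = of_real ((1 / cos x) ^ K) * cis (real K * x)"
    by (simp only: power_mult_distrib Complex.DeMoivre of_real_power)
  moreover have "real K * x = pi / 2"
    using assms by (simp add: x_def)
  ultimately show ?thesis
    unfolding x_def[symmetric] by (simp del: of_real_power of_real_divide)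
qed

text \<open>Induction on the roots: starting \<open>rot_poly\<close> from the polynomial
  \<open>u\<close> for \<open>Z\<close> keeps the roots of \<open>u\<close>, adds \<open>z\<close>,
  and costs a factor \<open>(1 + t\<^sup>2) ^ K\<close>.\<close>

lemma ex_poly_small_energy:
  assumes "finite Z" "\<And>z. z \<in> Z \<Longrightarrow> cmod z = 1" "K \<ge> 2"
  shows "\<exists>p. coeff p 0 = 1 \<and> degree p \<le> card Z * K \<and> (\<forall>z\<in>Z. poly p z = 0)
           \<and> energy p \<le> (1 + (tan (pi / (2 * real K)))\<^sup>2) ^ (card Z * K)"
  using assms(1,2)
proof (induction Z rule: finite_induct)
  case empty
  show ?case by (rule exI[of _ 1]) (simp add: energy_def)
next
  case (insert z Z)
  let ?t = "tan (pi / (2 * real K))"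
  obtain u where u: "coeff u 0 = 1" "degree u \<le> card Z * K" "\<forall>z\<in>Z. poly u z = 0"
      "energy u \<le> (1 + ?t\<^sup>2) ^ (card Z * K)"
    using insert by auto
  define w where "w = inverse z"
  have z1: "cmod z = 1"
    using insert by simp
  then have "z \<noteq> 0"
    by auto
  with z1 have w: "cmod w = 1" "w * z = 1"
    by (auto simp: w_def norm_inverse)
  define p where "p = fst (rot_poly w ?t u K)"
  \<comment> \<open>Dropping the energy of the second component, which is nonnegative.\<close>
  have "energy p \<le> (1 + ?t\<^sup>2) ^ K * energy u"
    using rot_poly_energy[OF w(1), of ?t u K]
    by (simp add: p_def energy_def sum_nonneg flip: energy_def)
       (smt (verit) energy_def sum_nonneg zero_le_power2)
  also have "\<dots> \<le> (1 + ?t\<^sup>2) ^ K * (1 + ?t\<^sup>2) ^ (card Z * K)"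
    using u(4) by (intro mult_left_mono) auto
  finally have "energy p \<le> (1 + ?t\<^sup>2) ^ (card (insert z Z) * K)"
    using insert by (simp add: power_add)
  moreover have "degree p \<le> card (insert z Z) * K"
    using rot_poly_degree[of w ?t u K] u(2) insert by (simp add: p_def)
  moreover have "\<forall>z\<in>insert z Z. poly p z = 0"
    using rot_poly_root[of u _ w ?t K] u(3) rot_poly_eval[OF w(2), of ?t u K]
      Re_Complex_tan_power[OF assms(3)]
    by (auto simp: p_def)
  moreover have "coeff p 0 = 1"
    by (simp add: p_def rot_poly_coeff_0 u(1))
  ultimately show ?case by blast
qed

section \<open>Riemann sums and the asymptotics of the constant\<close>

lemma riemann_sum_tendsto:
  fixes g :: "real \<Rightarrow> real"
  assumes "continuous_on {0..1} g"
  shows "(\<lambda>N. (\<Sum>k=1..N. g (real k / real N)) / real N) \<longlonglongrightarrow> integral {0..1} g"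
proof (rule LIMSEQ_I)
  fix e :: real
  assume "e > 0"
  have "uniformly_continuous_on {0..1} g"
    using assms compact_uniformly_continuous by blast
  then obtain d where d: "d > 0"
      "\<And>x y. x \<in> {0..1} \<Longrightarrow> y \<in> {0..1} \<Longrightarrow> dist y x < d \<Longrightarrow> dist (g y) (g x) < e / 2"
    using \<open>e > 0\<close> unfolding uniformly_continuous_on_def by (meson half_gt_zero)
  obtain M :: nat where M: "1 / d < real M"
    using reals_Archimedean2 by blast
  define G where "G x = integral {0..x} g" for x
  have G: "(G has_real_derivative g x) (at x within {0..1})" if "x \<in> {0..1}" for x
    unfolding G_def using assms that by (rule integral_has_real_derivative)
  show "\<exists>M. \<forall>N\<ge>M. norm ((\<Sum>k=1..N. g (real k / real N)) / real N - integral {0..1} g) < e"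
  proof (intro exI allI impI)
    fix N assume N: "N \<ge> M"
    have "N > 0"
      using M N d(1) by (smt (verit) divide_pos_pos gr0I le_zero_eq of_nat_0)
    have "1 / real N < d"
      using M N d(1) \<open>N > 0\<close> by (simp add: field_simps) (smt (verit) mult_left_mono of_nat_le_iff)
    \<comment> \<open>By the mean value theorem the increment of the antiderivative \<open>G\<close>
      is \<open>g x / real N\<close> for some \<open>x\<close> in the cell; uniform continuity
      compares \<open>g x\<close> with the right endpoint value.\<close>
    have step: "\<bar>g (real (Suc k) / real N) / real N - (G (real (Suc k) / real N) - G (real k / real N))\<bar>
        \<le> e / 2 / real N" if "k < N" for k
    proof -
      let ?a = "real k / real N" and ?b = "real (Suc k) / real N"
      have ab: "0 \<le> ?a" "?a < ?b" "?b \<le> 1" "?b - ?a = 1 / real N"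
        using \<open>N > 0\<close> that by (auto simp: field_simps)
      have "(G has_derivative (*) (g x)) (at x within {?a..?b})" if "?a \<le> x" "x \<le> ?b" for x
      proof -
        have "x \<in> {0..1}" "{?a..?b} \<subseteq> {0..1}"
          using ab(1,3) that order_trans[OF ab(1), of x] by (auto simp del: of_nat_Suc)
        then show ?thesis
          using G DERIV_subset unfolding has_field_derivative_def by blast
      qed
      then obtain x where x: "?a < x" "x < ?b" "G ?b - G ?a = g x * (?b - ?a)"
        using mvt_simple[OF ab(2), of G "\<lambda>x. (*) (g x)"] by (metis greaterThanLessThan_iff)
      have "dist (g ?b) (g x) < e / 2"
      proof (rule d(2))
        show "x \<in> {0..1}" "?b \<in> {0..1}"
          unfolding atLeastAtMost_iff using x(1,2) ab by linarith+
        show "dist ?b x < d"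
          unfolding dist_real_def using x(1,2) ab(4) \<open>1 / real N < d\<close> by linarith
      qed
      then have "\<bar>g ?b - g x\<bar> / real N \<le> e / 2 / real N"
        by (intro divide_right_mono) (auto simp: dist_real_def)
      moreover have "g ?b / real N - (G ?b - G ?a) = (g ?b - g x) / real N"
        using x(3) ab(4) by (simp only: diff_divide_distrib) simp
      ultimately show ?thesis
        by simp
    qed
    have "(\<Sum>k=1..N. g (real k / real N)) = (\<Sum>k<N. g (real (Suc k) / real N))"
      by (rule sum.reindex_bij_witness[of _ Suc "\<lambda>k. k - 1"]) auto
    moreover have "(\<Sum>k<N. G (real (Suc k) / real N) - G (real k / real N)) = integral {0..1} g"
      using sum_lessThan_telescope[of "\<lambda>k. G (real k / real N)" N] \<open>N > 0\<close> by (simp add: G_def)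
    ultimately have "(\<Sum>k=1..N. g (real k / real N)) / real N - integral {0..1} g
        = (\<Sum>k<N. g (real (Suc k) / real N) / real N - (G (real (Suc k) / real N) - G (real k / real N)))"
      by (simp add: sum_subtractf sum_divide_distrib)
    then have "\<bar>(\<Sum>k=1..N. g (real k / real N)) / real N - integral {0..1} g\<bar> \<le> (\<Sum>k<N. e / 2 / real N)"
      using step by (simp only:) (rule order_trans[OF sum_abs], rule sum_mono, simp only: lessThan_iff)
    also have "\<dots> < e"
      using \<open>N > 0\<close> \<open>e > 0\<close> by simp
    finally show "norm ((\<Sum>k=1..N. g (real k / real N)) / real N - integral {0..1} g) < e"
      by simp
  qed
qed

text \<open>Since \<open>tan x\<close> behaves like \<open>x\<close> near 0, the power minus 1 is
  asymptotic to \<open>n * K * (pi / (2 * K))\<^sup>2\<close>.\<close>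

lemma tan_power_tendsto:
  assumes "n \<ge> (1::nat)"
  shows "(\<lambda>K. real (n * K) * ((1 + (tan (pi / (2 * real K)))\<^sup>2) ^ (n * K) - 1))
           \<longlonglongrightarrow> (pi * real n / 2)\<^sup>2"
proof -
  define c where "c = real n"
  have "c > 0" using assms by (simp add: c_def)
  then have "((\<lambda>K::nat. c * real K * ((1 + (tan (pi / (2 * real K)))\<^sup>2) powr (c * real K) - 1))
           \<longlongrightarrow> (pi * c / 2)\<^sup>2) sequentially"
    by (real_asymp simp: power2_eq_square field_simps)
  moreover have "(1 + (tan x)\<^sup>2) powr (c * real K) = (1 + (tan x)\<^sup>2) ^ (n * K)" for x K
    using powr_realpow[of "1 + (tan x)\<^sup>2" "n * K"] by (simp add: c_def add_pos_nonneg)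
  ultimately show ?thesis
    by (simp add: c_def)
qed

section \<open>The bound at an endpoint\<close>

lemma exp_sum_endpoint_bound:
  fixes a :: "'a \<Rightarrow> complex" and \<mu> :: "'a \<Rightarrow> real"
  assumes "finite J" "J \<noteq> {}"
  defines "g \<equiv> \<lambda>t. \<Sum>j\<in>J. a j * exp (\<i> * of_real (\<mu> j * t))"
  shows "(cmod (g 0))\<^sup>2 \<le> (pi * real (card J) / 2)\<^sup>2 * integral {0..1} (\<lambda>t. (cmod (g t))\<^sup>2)"
proof -
  define n where "n = card J"
  have n: "n \<ge> 1"
    using assms by (simp add: n_def Suc_le_eq card_gt_0_iff)
  define C where "C K = (1 + (tan (pi / (2 * real K)))\<^sup>2) ^ (n * K)" for K
  have bound: "(cmod (g 0))\<^sup>2 \<le> (C K - 1) * (\<Sum>k=1..n*K. (cmod (g (real k / real (n * K))))\<^sup>2)"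
    if K: "K \<ge> 2" for K
  proof -
    define N where "N = n * K"
    define e where "e j = exp (\<i> * of_real (\<mu> j / real N))" for j
    have e_power: "e j ^ k = exp (\<i> * of_real (\<mu> j * (real k / real N)))" for j k
      unfolding e_def by (simp add: mult_ac flip: exp_of_nat_mult)
    have eJ: "cmod z = 1" if "z \<in> e ` J" for z
      using that by (auto simp: e_def)
    obtain p where p: "coeff p 0 = 1" "degree p \<le> card (e ` J) * K" "\<forall>z\<in>e ` J. poly p z = 0"
       "energy p \<le> (1 + (tan (pi / (2 * real K)))\<^sup>2) ^ (card (e ` J) * K)"
      using ex_poly_small_energy[OF _ eJ K] assms(1) by blast
    \<comment> \<open>The map \<open>e\<close> may identify several frequencies, so there may be
      fewer than \<open>n\<close> roots; the base of the power is at least 1, so the bound with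
      \<open>n\<close> still holds.\<close>
    have card: "card (e ` J) * K \<le> N"
      using card_image_le[OF assms(1), of e] by (simp add: N_def n_def)
    then have "degree p \<le> N"
      using p(2) by simp
    have "energy p \<le> C K"
      using p(4) power_increasing[OF card, of "1 + (tan (pi / (2 * real K)))\<^sup>2"]
      by (simp add: C_def N_def)
    have split: "(\<Sum>k\<le>N. h k) = h 0 + (\<Sum>k=1..N. h k)" for h :: "nat \<Rightarrow> 'b::comm_monoid_add"
      by (simp add: sum.atMost_shift sum.atLeast1_atMost_eq)
    \<comment> \<open>The constant coefficient contributes exactly 1 to the energy.\<close>
    have tail: "(\<Sum>k=1..N. (cmod (coeff p k))\<^sup>2) \<le> C K - 1"
      using \<open>energy p \<le> C K\<close> energy_eq_sum[OF \<open>degree p \<le> N\<close>] p(1) by (simp add: split)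
    \<comment> \<open>The samples are \<open>\<Sum>j\<in>J. a j * e j ^ k\<close>, so exchanging the
      sums produces the values of \<open>p\<close> at its roots.\<close>
    have "(\<Sum>k\<le>N. coeff p k * g (real k / real N)) = (\<Sum>k\<le>N. \<Sum>j\<in>J. a j * (coeff p k * e j ^ k))"
      by (simp add: g_def e_power sum_distrib_left mult_ac)
    also have "\<dots> = (\<Sum>j\<in>J. a j * (\<Sum>k\<le>N. coeff p k * e j ^ k))"
      by (subst sum.swap) (simp add: sum_distrib_left)
    also have "\<dots> = (\<Sum>j\<in>J. a j * poly p (e j))"
    proof -
      have "poly p z = (\<Sum>k\<le>N. coeff p k * z ^ k)" for z
        unfolding poly_altdef using \<open>degree p \<le> N\<close>
        by (intro sum.mono_neutral_left) (auto simp: coeff_eq_0)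
      then show ?thesis by simp
    qed
    also have "\<dots> = 0"
      using p(3) by simp
    finally have "g 0 = - (\<Sum>k=1..N. coeff p k * g (real k / real N))"
      by (simp add: split p(1) eq_neg_iff_add_eq_0)
    then have "cmod (g 0) \<le> (\<Sum>k=1..N. cmod (coeff p k) * cmod (g (real k / real N)))"
      using norm_sum[of "\<lambda>k. coeff p k * g (real k / real N)" "{1..N}"] by (simp add: norm_mult)
    then have "(cmod (g 0))\<^sup>2 \<le> (\<Sum>k=1..N. cmod (coeff p k) * cmod (g (real k / real N)))\<^sup>2"
      by (intro power_mono) auto
    also have "\<dots> \<le> (\<Sum>k=1..N. (cmod (coeff p k))\<^sup>2) * (\<Sum>k=1..N. (cmod (g (real k / real N)))\<^sup>2)"
      by (rule Cauchy_Schwarz_ineq_sum)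
    also have "\<dots> \<le> (C K - 1) * (\<Sum>k=1..N. (cmod (g (real k / real N)))\<^sup>2)"
      using tail by (intro mult_right_mono sum_nonneg) auto
    finally show ?thesis
      by (simp add: N_def)
  qed
  have "continuous_on {0..1} (\<lambda>t. (cmod (g t))\<^sup>2)"
    unfolding g_def by (intro continuous_intros)
  then have "(\<lambda>N. (\<Sum>k=1..N. (cmod (g (real k / real N)))\<^sup>2) / real N)
      \<longlonglongrightarrow> integral {0..1} (\<lambda>t. (cmod (g t))\<^sup>2)"
    by (rule riemann_sum_tendsto)
  moreover have "filterlim (\<lambda>K. n * K) sequentially sequentially"
    using n by (intro filterlim_subseq strict_monoI) auto
  ultimately have "(\<lambda>K. (\<Sum>k=1..n*K. (cmod (g (real k / real (n * K))))\<^sup>2) / real (n * K))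
      \<longlonglongrightarrow> integral {0..1} (\<lambda>t. (cmod (g t))\<^sup>2)"
    by (rule filterlim_compose)
  \<comment> \<open>Multiplying and dividing by \<open>n * K\<close> gives two factors that both
    converge.\<close>
  then have "(\<lambda>K. real (n * K) * (C K - 1) * ((\<Sum>k=1..n*K. (cmod (g (real k / real (n * K))))\<^sup>2) / real (n * K)))
      \<longlonglongrightarrow> (pi * real n / 2)\<^sup>2 * integral {0..1} (\<lambda>t. (cmod (g t))\<^sup>2)"
    unfolding C_def by (intro tendsto_mult tan_power_tendsto n)
  then show ?thesis
    unfolding n_def[symmetric]
  proof (rule LIMSEQ_le_const)
    show "\<exists>N. \<forall>K\<ge>N. (cmod (g 0))\<^sup>2
        \<le> real (n * K) * (C K - 1) * ((\<Sum>k=1..n*K. (cmod (g (real k / real (n * K))))\<^sup>2) / real (n * K))"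
      using bound n by (intro exI[of _ 2]) auto
  qed
qed

section \<open>Rescaling and interior points\<close>

lemma integral_affine_01:
  fixes h :: "real \<Rightarrow> real"
  assumes "continuous_on UNIV h" "c \<noteq> 0"
  shows "\<bar>c\<bar> * integral {0..1} (\<lambda>t. h (y + c * t)) = integral (closed_segment y (y + c)) h"
proof -
  \<comment> \<open>The minimum and maximum allow \<open>c < 0\<close>, needed for the interval to
    the left of \<open>y\<close>.\<close>
  have im: "(\<lambda>x. (1 / c) *\<^sub>R x + - ((1 / c) *\<^sub>R y)) ` cbox (min y (y + c)) (max y (y + c)) = cbox 0 1"
    unfolding image_affinity_cbox using assms(2)
    by (cases "c > 0") (simp_all add: min_def max_def field_simps)
  have "h integrable_on cbox (min y (y + c)) (max y (y + c))"
    by (intro integrable_continuous continuous_on_subset[OF assms(1)]) auto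
  then have "(h has_integral integral (cbox (min y (y + c)) (max y (y + c))) h) (cbox (min y (y + c)) (max y (y + c)))"
    by (rule integrable_integral)
  from has_integral_affinity[OF this assms(2), of y] im
  have "((\<lambda>t. h (y + c * t)) has_integral integral (cbox (min y (y + c)) (max y (y + c))) h / \<bar>c\<bar>) {0..1}"
    by (simp add: add.commute)
  then have "integral {0..1} (\<lambda>t. h (y + c * t)) = integral (cbox (min y (y + c)) (max y (y + c))) h / \<bar>c\<bar>"
    by (rule integral_unique)
  moreover have "closed_segment y (y + c) = cbox (min y (y + c)) (max y (y + c))"
    by (auto simp: closed_segment_eq_real_ivl)
  ultimately show ?thesis
    using assms(2) by simp
qed

theorem theorem2p3:
  fixes n :: nat and f :: "real \<Rightarrow> complex"
  assumes "n \<ge> 1" and "f \<in> exp_sums n"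
  shows "sup_norm_on {0..1} f \<le> pi * real n / 2 * L2_norm_01 f"
proof -
  obtain a lam where f: "f = (\<lambda>t. \<Sum>j=1..n. a j * exp (\<i> * complex_of_real (lam j * t)))"
    using assms(2) by (auto simp: exp_sums_def)
  define h where "h t = (cmod (f t))\<^sup>2" for t
  define C where "C = (pi * real n / 2)\<^sup>2"
  have cont: "continuous_on S h" for S
    unfolding h_def f by (intro continuous_intros)
  \<comment> \<open>The endpoint bound on the segment from \<open>y\<close> to \<open>y + c\<close>,
    multiplied by its length so that the bounds on both sides of \<open>y\<close> can be
    added.\<close>
  have segment: "\<bar>c\<bar> * h y \<le> C * integral (closed_segment y (y + c)) h" for y c
  proof (cases "c = 0")
    case False
    \<comment> \<open>This is \<open>f\<close> along the segment: the phase at \<open>y\<close> goes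
      into the coefficients and the frequencies are scaled by \<open>c\<close>.\<close>
    define g where "g = (\<lambda>t. \<Sum>j=1..n. (a j * exp (\<i> * of_real (lam j * y))) * exp (\<i> * of_real ((lam j * c) * t)))"
    have g: "g t = f (y + c * t)" for t
      unfolding g_def f
      by (intro sum.cong refl) (simp add: algebra_simps flip: exp_add)
    have "(cmod (g 0))\<^sup>2 \<le> C * integral {0..1} (\<lambda>t. (cmod (g t))\<^sup>2)"
      using exp_sum_endpoint_bound[of "{1..n}" "\<lambda>j. a j * exp (\<i> * of_real (lam j * y))" "\<lambda>j. lam j * c"] assms(1)
      by (simp add: g_def C_def)
    then have "h y \<le> C * integral {0..1} (\<lambda>t. h (y + c * t))"
      by (simp add: g h_def)
    then have "\<bar>c\<bar> * h y \<le> C * (\<bar>c\<bar> * integral {0..1} (\<lambda>t. h (y + c * t)))"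
      by (metis abs_ge_zero mult.left_commute mult_left_mono)
    then show ?thesis
      using integral_affine_01[OF cont False] by simp
  qed simp
  have "cmod (f y) \<le> pi * real n / 2 * L2_norm_01 f" if "y \<in> {0..1}" for y
  proof -
    have "(1 - y) * h y \<le> C * integral {y..1} h" "y * h y \<le> C * integral {0..y} h"
      using segment[of "1 - y" y] segment[of "- y" y] that
      by (cases "y = 0"; auto simp: closed_segment_eq_real_ivl)+
    then have "h y \<le> C * (integral {0..y} h + integral {y..1} h)"
      by (simp add: algebra_simps)
    also have "integral {0..y} h + integral {y..1} h = integral {0..1} h"
      using that by (intro Henstock_Kurzweil_Integration.integral_combine integrable_continuous_interval cont) auto
    finally have "sqrt (h y) \<le> sqrt (C * integral {0..1} h)"
      by simp
    then show ?thesis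
      by (simp add: h_def[abs_def] C_def L2_norm_01_def real_sqrt_mult)
  qed
  then show ?thesis
    unfolding sup_norm_on_def by (intro cSUP_least) auto
qed

end
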